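(* Let $H$ be a connected graph on at least three vertices which has a non-pendant edge not contained in any triangle. Then for any integers $t\geq e(H)$ and $n\geq 1$, \[\operatorname{sat}_t(n,\mathfrak{R}(H))\leq c_H\cdot n,\quad\text{where } c_H=e(H)\cdot(|H|-2).\]
   Context: A $t$-edge-coloured graph is a graph $G$ with a function $c:E(G)\to\{1,\dots,t\}$ (not necessarily proper). A copy of $H$ is rainbow if all its edges receive distinct colours; $\mathfrak{R}(H)$ denotes the family of rainbow copies of $H$. A $t$-edge-coloured graph is $\mathfrak{R}(H)$-saturated if it contains no rainbow copy of $H$ but adding any non-edge in any colour from $\{1,\dots,t\}$ creates a rainbow copy of $H$. $\operatorname{sat}_t(n,\mathfrak{R}(H))$ is the minimum number of edges of such a graph on $n$ vertices. An edge is pendant if one of its endpoints has degree $1$. *)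

theory Defs
  imports Main
begin

text \<open>An undirected graph is a pair of a vertex set and a set of edges, each edge being a
  two-element set of vertices. All graphs are finite and simple.\<close>

type_synonym 'a graph = "'a set \<times> 'a set set"

abbreviation verts :: "'a graph \<Rightarrow> 'a set" where
  "verts G \<equiv> fst G"

abbreviation edges :: "'a graph \<Rightarrow> 'a set set" where
  "edges G \<equiv> snd G"

definition all_pairs :: "'a set \<Rightarrow> 'a set set" where
  "all_pairs V = {e. e \<subseteq> V \<and> card e = 2}"

definition simple_graph :: "'a graph \<Rightarrow> bool" where
  "simple_graph G \<longleftrightarrow> finite (verts G) \<and> edges G \<subseteq> all_pairs (verts G)"

definition connected_graph :: "'a graph \<Rightarrow> bool" where
  "connected_graph G \<longleftrightarrow> verts G \<noteq> {} \<and>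
     (\<forall>u\<in>verts G. \<forall>v\<in>verts G. (u, v) \<in> {(x, y). {x, y} \<in> edges G}\<^sup>*)"

definition degree :: "'a graph \<Rightarrow> 'a \<Rightarrow> nat" where
  "degree G v = card {e \<in> edges G. v \<in> e}"

definition pendant :: "'a graph \<Rightarrow> 'a set \<Rightarrow> bool" where
  "pendant G e \<longleftrightarrow> e \<in> edges G \<and> (\<exists>v\<in>e. degree G v = 1)"

definition in_triangle :: "'a graph \<Rightarrow> 'a set \<Rightarrow> bool" where
  "in_triangle G e \<longleftrightarrow> (\<exists>x y z. x \<noteq> y \<and> y \<noteq> z \<and> x \<noteq> z \<and> e = {x, y} \<and>
     {x, y} \<in> edges G \<and> {y, z} \<in> edges G \<and> {x, z} \<in> edges G)"

definition isomorphic :: "'a graph \<Rightarrow> 'b graph \<Rightarrow> bool" where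
  "isomorphic G K \<longleftrightarrow>
     (\<exists>f. bij_betw f (verts G) (verts K) \<and> edges K = (`) f ` edges G)"

definition subgraph :: "'a graph \<Rightarrow> 'a graph \<Rightarrow> bool" where
  "subgraph K G \<longleftrightarrow> verts K \<subseteq> verts G \<and> edges K \<subseteq> edges G"

text \<open>Edge colourings are total functions on sets of vertices; only their values on the
  edges of the graph are relevant, and they need not be proper.\<close>

definition edge_coloured :: "nat \<Rightarrow> 'a graph \<Rightarrow> ('a set \<Rightarrow> nat) \<Rightarrow> bool" where
  "edge_coloured t G c \<longleftrightarrow> simple_graph G \<and> c ` edges G \<subseteq> {1..t}"

definition rainbow_copy ::
  "'b graph \<Rightarrow> 'a graph \<Rightarrow> ('a set \<Rightarrow> nat) \<Rightarrow> 'a graph \<Rightarrow> bool" where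
  "rainbow_copy H G c K \<longleftrightarrow> subgraph K G \<and> isomorphic H K \<and> inj_on c (edges K)"

definition rainbow_saturated ::
  "nat \<Rightarrow> 'b graph \<Rightarrow> 'a graph \<Rightarrow> ('a set \<Rightarrow> nat) \<Rightarrow> bool" where
  "rainbow_saturated t H G c \<longleftrightarrow> edge_coloured t G c \<and>
     (\<nexists>K. rainbow_copy H G c K) \<and>
     (\<forall>e \<in> all_pairs (verts G) - edges G. \<forall>i\<in>{1..t}.
        \<exists>K. rainbow_copy H (verts G, insert e (edges G)) (c(e := i)) K)"

text \<open>Every finite graph is isomorphic to one whose vertices are natural numbers, so it
  suffices to minimise over those. The minimum is attained whenever \<open>H\<close> has at least two
  edges and \<open>t \<ge> 1\<close>; see \<open>rainbow_sat_attained\<close> below.\<close>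

definition rainbow_sat :: "nat \<Rightarrow> nat \<Rightarrow> 'b graph \<Rightarrow> nat" where
  "rainbow_sat t n H = (LEAST m. \<exists>(G :: nat graph) c.
     card (verts G) = n \<and> rainbow_saturated t H G c \<and> card (edges G) = m)"

lemma card_edges_isomorphic:
  assumes "simple_graph H" "isomorphic H K"
  shows "card (edges K) = card (edges H)"
proof -
  obtain f where f: "bij_betw f (verts H) (verts K)" "edges K = (`) f ` edges H"
    using assms(2) by (auto simp: isomorphic_def)
  have "edges H \<subseteq> Pow (verts H)"
    using assms(1) by (auto simp: simple_graph_def all_pairs_def)
  moreover have "inj_on ((`) f) (Pow (verts H))"
    using f(1) by (simp add: bij_betw_def inj_on_image_Pow)
  ultimately have "inj_on ((`) f) (edges H)"
    by (rule inj_on_subset[rotated])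
  then show ?thesis
    using f(2) by (simp add: card_image)
qed

text \<open>Monochromatic complete graphs are saturated.\<close>

lemma rainbow_saturated_complete:
  fixes V :: "'a set"
  assumes "simple_graph H" "2 \<le> card (edges H)" "1 \<le> t" "finite V"
  shows "rainbow_saturated t H (V, all_pairs V) (\<lambda>_. 1)"
proof -
  have False if "rainbow_copy H (V, all_pairs V) (\<lambda>_. 1) K" for K
  proof -
    have "card (edges K) = card (edges H)"
      using that assms(1) card_edges_isomorphic unfolding rainbow_copy_def by blast
    moreover have "card (edges K) \<le> card {1 :: nat}"
      using that by (intro card_inj_on_le[of "\<lambda>_. 1"]) (auto simp: rainbow_copy_def)
    ultimately show False
      using assms(2) by simp
  qed
  then show ?thesis
    using assms(3,4)
    by (auto simp: rainbow_saturated_def edge_coloured_def simple_graph_def)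
qed

lemma rainbow_sat_attained:
  assumes "simple_graph H" "2 \<le> card (edges H)" "1 \<le> t"
  shows "\<exists>(G :: nat graph) c. card (verts G) = n \<and> rainbow_saturated t H G c \<and>
           card (edges G) = rainbow_sat t n H"
  unfolding rainbow_sat_def
proof (rule LeastI_ex)
  show "\<exists>m (G :: nat graph) c. card (verts G) = n \<and> rainbow_saturated t H G c \<and>
          card (edges G) = m"
    using rainbow_saturated_complete[OF assms, of "{..<n}"]
    by (intro exI[of _ "card (all_pairs {..<n})"] exI[of _ "({..<n}, all_pairs {..<n})"]
        exI[of _ "\<lambda>_. 1"]) simp
qed

end

theory Submission imports Defs
begin

text \<open>
  Let \<open>k = e(H)\<close> and call an edge critical if it is neither pendant nor in a triangle. Take a
  critical edge \<open>xy\<close> maximising \<open>d(x) + d(y)\<close>. Glue \<open>k\<close> copies of the contraction \<open>H/xy\<close> at the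
  contracted vertex and blow that vertex up to an independent set \<open>B\<close>; since \<open>xy\<close> lies in no
  triangle, the edges of \<open>H/xy\<close> are exactly the edges of \<open>H\<close> other than \<open>xy\<close>. Copy \<open>j\<close> is
  rainbow in the colours \<open>{1..k} - {j}\<close>: it has a fixed colouring by \<open>{1..<k}\<close>, with colour
  \<open>j\<close> replaced by \<open>k\<close>. An edge added inside \<open>B\<close> in colour \<open>i\<close> plays the role of \<open>xy\<close> and
  completes a rainbow \<open>H\<close> with copy \<open>i\<close>. Hence in a maximal rainbow-\<open>H\<close>-free extension every
  edge meets the complement of \<open>B\<close>, which has \<open>k (|H| - 2)\<close> vertices.

  Suppose the construction contained a rainbow copy \<open>K\<close> of \<open>H\<close>. It uses all \<open>k\<close> colours, so it
  contains each edge of \<open>H/xy\<close> once, except for one edge \<open>m\<close> which occurs in two different copies.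
  Counting vertices, \<open>K\<close> has a single vertex \<open>z\<close> in \<open>B\<close>, and \<open>m\<close> joins the contracted vertex to
  some \<open>s\<close>, the only vertex occurring twice. Then \<open>z\<close> has degree \<open>d(x) + d(y) - 1\<close> in \<open>K\<close>, so by
  maximality no edge at \<open>z\<close> is critical in \<open>K\<close>, while an edge of \<open>K\<close> away from \<open>z\<close> that is
  critical in \<open>K\<close> comes from an edge critical in \<open>H\<close>. So \<open>K\<close> has fewer critical edges than \<open>H\<close>.
\<close>

section \<open>Maximal rainbow-free extensions\<close>

text \<open>Each such pair has an end outside \<open>B\<close>: there are
  \<open>card (V - B)\<close> choices for it and at most \<open>card V\<close> for the other
  end.\<close>

lemma card_all_pairs_diff_le:
  assumes "finite V" "B \<subseteq> V"
  shows "card (all_pairs V - all_pairs B) \<le> card (V - B) * card V"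
proof -
  have "all_pairs V - all_pairs B \<subseteq> (\<lambda>(a, v). {a, v}) ` ((V - B) \<times> V)"
  proof
    fix e assume e: "e \<in> all_pairs V - all_pairs B"
    then obtain a b where ab: "e = {a, b}" "a \<in> V" "b \<in> V" "a \<noteq> b"
      by (auto simp: all_pairs_def card_2_iff)
    with e have "a \<notin> B \<or> b \<notin> B"
      by (auto simp: all_pairs_def)
    then show "e \<in> (\<lambda>(a, v). {a, v}) ` ((V - B) \<times> V)"
      using ab by (auto simp: image_iff insert_commute)
  qed
  then have "card (all_pairs V - all_pairs B) \<le> card ((V - B) \<times> V)"
    using assms by (intro surj_card_le) auto
  then show ?thesis
    by (simp add: card_cartesian_product)
qed

lemma finite_all_pairs: "finite V \<Longrightarrow> finite (all_pairs V)"
  by (rule finite_subset[of _ "Pow V"]) (auto simp: all_pairs_def)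

lemma rainbow_copy_mono:
  assumes "rainbow_copy H G c K" "verts G \<subseteq> verts G'" "edges G \<subseteq> edges G'"
    and "\<And>e. e \<in> edges G \<Longrightarrow> c' e = c e"
  shows "rainbow_copy H G' c' K"
proof -
  have "inj_on c (edges K)" "edges K \<subseteq> edges G"
    using assms(1) by (auto simp: rainbow_copy_def subgraph_def)
  then have "inj_on c' (edges K)"
    using assms(4) by (auto simp: inj_on_def subset_iff)
  then show ?thesis
    using assms by (auto simp: rainbow_copy_def subgraph_def)
qed

text \<open>A maximal rainbow-free extension of \<open>G\<close> is saturated, and it can never gain an edge
  inside \<open>B\<close>.\<close>

lemma rainbow_saturated_extension:
  assumes col: "edge_coloured t G c"
    and free: "\<nexists>K. rainbow_copy H G c K"
    and B: "B \<subseteq> verts G"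
    and add: "\<And>e i. e \<in> all_pairs B \<Longrightarrow> i \<in> {1..t} \<Longrightarrow>
      \<exists>K. rainbow_copy H (verts G, insert e (edges G)) (c(e := i)) K"
  shows "\<exists>E c'. rainbow_saturated t H (verts G, E) c' \<and>
    card E \<le> card (verts G - B) * card (verts G)"
proof -
  let ?V = "verts G"
  have fin: "finite ?V" and E0: "edges G \<subseteq> all_pairs ?V" and c0: "c ` edges G \<subseteq> {1..t}"
    using col by (auto simp: edge_coloured_def simple_graph_def)
  \<comment> \<open>Edge set and colouring grow together, so maximality ranges over pairs;
    \<open>c'\<close> has to agree with \<open>c\<close> on the old edges only.\<close>
  define P where "P = (\<lambda>(E, c'). edges G \<subseteq> E \<and> E \<subseteq> all_pairs ?V \<and> (\<forall>e\<in>edges G. c' e = c e) \<and>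
    c' ` E \<subseteq> {1..t} \<and> (\<nexists>K. rainbow_copy H (?V, E) c' K))"
  have P0: "P (edges G, c)"
    using E0 c0 free by (auto simp: P_def)
  have bound: "\<forall>p. P p \<longrightarrow> card (fst p) < Suc (card (all_pairs ?V))"
    using finite_all_pairs[OF fin] by (auto simp: P_def less_Suc_eq_le intro: card_mono)
  obtain p where p: "P p" and pmax: "\<And>q. P q \<Longrightarrow> card (fst q) \<le> card (fst p)"
    using ex_has_greatest_nat[of P "(edges G, c)" "\<lambda>p. card (fst p)", OF P0 bound] by blast
  obtain E c' where pE: "p = (E, c')"
    by (cases p)
  have E: "edges G \<subseteq> E" "E \<subseteq> all_pairs ?V" "\<forall>e\<in>edges G. c' e = c e" "c' ` E \<subseteq> {1..t}"
    "\<nexists>K. rainbow_copy H (?V, E) c' K"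
    using p by (auto simp: P_def pE)
  have finE: "finite E"
    using E(2) finite_all_pairs[OF fin] by (rule finite_subset)
  have sat: "\<exists>K. rainbow_copy H (?V, insert e E) (c'(e := i)) K"
    if e: "e \<in> all_pairs ?V - E" and i: "i \<in> {1..t}" for e i
  proof (rule ccontr)
    assume "\<not> ?thesis"
    then have "P (insert e E, c'(e := i))"
      using e i E by (auto simp: P_def)
    from pmax[OF this] show False
      using finE e by (simp add: pE)
  qed
  have "E \<inter> all_pairs B = {}"
  proof (rule ccontr)
    assume "\<not> ?thesis"
    then obtain e where e: "e \<in> E" "e \<in> all_pairs B"
      by auto
    then have "c' e \<in> {1..t}"
      using E(4) by auto
    \<comment> \<open>Apply \<open>add\<close> with the colour that \<open>e\<close> already has in
      the extension: the copy it yields then lies in \<open>(?V, E)\<close>.\<close>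
    from add[OF e(2) this] obtain K where
      "rainbow_copy H (?V, insert e (edges G)) (c(e := c' e)) K" ..
    then have "rainbow_copy H (?V, E) c' K"
      using E e(1) by (elim rainbow_copy_mono) auto
    then show False
      using E(5) by blast
  qed
  then have "card E \<le> card (all_pairs ?V - all_pairs B)"
    using E(2) finite_all_pairs[OF fin] by (intro card_mono) auto
  also have "\<dots> \<le> card (?V - B) * card ?V"
    by (rule card_all_pairs_diff_le[OF fin B])
  finally have "card E \<le> card (?V - B) * card ?V" .
  moreover have "rainbow_saturated t H (?V, E) c'"
    using E sat fin by (auto simp: rainbow_saturated_def edge_coloured_def simple_graph_def)
  ultimately show ?thesis
    by blast
qed

section \<open>Critical edges\<close>

definition critical_edges :: "'a graph \<Rightarrow> 'a set set" where
  "critical_edges G = {e \<in> edges G. \<not> pendant G e \<and> \<not> in_triangle G e}"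

lemma in_triangleI:
  assumes "{a, b} \<in> edges G" "{b, d} \<in> edges G" "{a, d} \<in> edges G" "a \<noteq> b" "b \<noteq> d" "a \<noteq> d"
  shows "in_triangle G {a, b}"
  using assms unfolding in_triangle_def by blast

lemma in_triangleE:
  assumes "in_triangle G {a, b}"
  obtains d where "{a, d} \<in> edges G" "{b, d} \<in> edges G" "a \<noteq> d" "b \<noteq> d"
proof -
  obtain u v d where "u \<noteq> v" "v \<noteq> d" "u \<noteq> d" "{a, b} = {u, v}"
    "{v, d} \<in> edges G" "{u, d} \<in> edges G"
    using assms unfolding in_triangle_def by blast
  then show ?thesis
    using that[of d] by (auto simp: doubleton_eq_iff)
qed

lemma degree_ge_2_if_critical:
  assumes "e \<in> critical_edges G" "v \<in> e" "finite (edges G)"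
  shows "2 \<le> degree G v"
proof -
  have "degree G v \<noteq> 1" "e \<in> edges G"
    using assms by (auto simp: critical_edges_def pendant_def)
  moreover from this have "degree G v \<noteq> 0"
    using assms(2,3) by (auto simp: degree_def)
  ultimately show ?thesis
    by linarith
qed

context
  fixes H :: "'a graph" and K :: "'b graph" and f :: "'a \<Rightarrow> 'b"
  assumes simple: "simple_graph H"
    and f: "bij_betw f (verts H) (verts K)" "edges K = (`) f ` edges H"
begin

lemma edge_subset_iso: "e \<in> edges H \<Longrightarrow> e \<subseteq> verts H"
  using simple by (auto simp: simple_graph_def all_pairs_def)

lemma inj_iso: "inj_on f (verts H)"
  using f(1) by (simp add: bij_betw_def)

lemma inj_on_image_edges: "inj_on ((`) f) (edges H)"
  by (rule inj_on_subset[OF inj_on_image_Pow[OF inj_iso]]) (use edge_subset_iso in auto)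

lemma degree_iso:
  assumes "v \<in> verts H"
  shows "degree K (f v) = degree H v"
proof -
  have "f v \<in> f ` e \<longleftrightarrow> v \<in> e" if "e \<in> edges H" for e
    using inj_on_image_mem_iff[OF inj_iso assms edge_subset_iso[OF that]] .
  then have "{e \<in> edges K. f v \<in> e} = (`) f ` {e \<in> edges H. v \<in> e}"
    unfolding f(2) by auto
  then show ?thesis
    unfolding degree_def
    by (simp add: card_image inj_on_subset[OF inj_on_image_edges])
qed

lemma edge_iso_iff:
  assumes "e \<subseteq> verts H"
  shows "f ` e \<in> edges K \<longleftrightarrow> e \<in> edges H"
  using assms edge_subset_iso inj_on_image_eq_iff[OF inj_iso] unfolding f(2) by auto

lemma in_triangle_iso:
  assumes "e \<in> edges H" "in_triangle H e"
  shows "in_triangle K (f ` e)"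
proof -
  obtain a b d where abd: "a \<noteq> b" "b \<noteq> d" "a \<noteq> d" "e = {a, b}"
    "{a, b} \<in> edges H" "{b, d} \<in> edges H" "{a, d} \<in> edges H"
    using assms(2) by (auto simp: in_triangle_def)
  have V: "a \<in> verts H" "b \<in> verts H" "d \<in> verts H"
    using edge_subset_iso abd by blast+
  have "{f a, f b} \<in> edges K" "{f b, f d} \<in> edges K" "{f a, f d} \<in> edges K"
    using abd edge_iso_iff[of "{_, _}"] V by auto
  moreover have "f a \<noteq> f b" "f b \<noteq> f d" "f a \<noteq> f d"
    using inj_iso V abd by (auto simp: inj_on_eq_iff)
  ultimately show ?thesis
    unfolding abd(4) image_insert image_empty by (rule in_triangleI)
qed

lemma in_triangle_iso_rev:
  assumes "e \<in> edges H" "in_triangle K (f ` e)"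
  shows "in_triangle H e"
proof -
  obtain a' b' d' where abd': "a' \<noteq> b'" "b' \<noteq> d'" "a' \<noteq> d'" "f ` e = {a', b'}"
    "{a', b'} \<in> edges K" "{b', d'} \<in> edges K" "{a', d'} \<in> edges K"
    using assms(2) by (auto simp: in_triangle_def)
  have "\<Union> (edges K) \<subseteq> f ` verts H"
    unfolding f(2) using edge_subset_iso by blast
  then have "{a', b', d'} \<subseteq> f ` verts H"
    using abd' by blast
  then obtain a b d where V: "a \<in> verts H" "b \<in> verts H" "d \<in> verts H"
    "a' = f a" "b' = f b" "d' = f d"
    by auto
  have "{a, b} \<in> edges H" "{b, d} \<in> edges H" "{a, d} \<in> edges H"
    using abd' edge_iso_iff[of "{_, _}"] V by auto
  moreover have "a \<noteq> b" "b \<noteq> d" "a \<noteq> d"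
    using abd' V by auto
  ultimately have "in_triangle H {a, b}"
    by (rule in_triangleI)
  moreover have "e = {a, b}"
  proof -
    have "f ` e = f ` {a, b}"
      using abd'(4) V by simp
    then show ?thesis
      using inj_on_image_eq_iff[OF inj_iso edge_subset_iso[OF assms(1)], of "{a, b}"] V by simp
  qed
  ultimately show ?thesis
    by simp
qed

text \<open>Degrees and triangles transfer in both directions. The resulting equality of
  cardinalities is what a rainbow copy in the construction will violate.\<close>

lemma critical_edges_iso: "critical_edges K = (`) f ` critical_edges H"
proof -
  have "f ` e \<in> critical_edges K \<longleftrightarrow> e \<in> critical_edges H" if e: "e \<in> edges H" for e
  proof -
    have "pendant K (f ` e) \<longleftrightarrow> pendant H e"
      using e edge_subset_iso[OF e] f(2)
      by (auto simp: pendant_def degree_iso[OF subsetD[OF edge_subset_iso[OF e]]])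
    then show ?thesis
      using e f(2) in_triangle_iso[OF e] in_triangle_iso_rev[OF e]
      by (auto simp: critical_edges_def)
  qed
  moreover have "critical_edges K \<subseteq> (`) f ` edges H" "critical_edges H \<subseteq> edges H"
    using f(2) by (auto simp: critical_edges_def)
  ultimately show ?thesis
    by (auto 0 3)
qed

lemma card_critical_edges_iso: "card (critical_edges K) = card (critical_edges H)"
  unfolding critical_edges_iso
  by (intro card_image inj_on_subset[OF inj_on_image_edges]) (auto simp: critical_edges_def)

lemma sum_degree_iso:
  assumes "e \<in> edges H"
  shows "sum (degree K) (f ` e) = sum (degree H) e"
proof -
  have "inj_on f e"
    using inj_iso edge_subset_iso[OF assms] by (rule inj_on_subset)
  then show ?thesis
    using edge_subset_iso[OF assms] degree_iso by (auto simp: sum.reindex intro!: sum.cong)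
qed

end

section \<open>Copies of the contraction glued along an independent set\<close>

text \<open>\<open>\<phi> j w\<close> is the vertex \<open>w\<close> of the \<open>j\<close>-th copy, and \<open>lift j b f\<close> below is the edge of that copy
  coming from \<open>f\<close>, with \<open>b\<close> in place of the contracted vertex.\<close>

locale contraction_copies =
  fixes H :: "'a graph" and x y :: 'a and \<nu> :: "'a set \<Rightarrow> nat"
    and \<phi> :: "nat \<Rightarrow> 'a \<Rightarrow> 'b" and B :: "'b set"
  assumes simple: "simple_graph H"
    and connected: "connected_graph H"
    and critical: "{x, y} \<in> critical_edges H"
    and maximal: "\<And>e. e \<in> critical_edges H \<Longrightarrow> sum (degree H) e \<le> sum (degree H) {x, y}"
    and bij_\<nu>: "bij_betw \<nu> (edges H - {{x, y}}) {1..<card (edges H)}"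
    and inj_\<phi>: "inj_on (case_prod \<phi>) ({1..card (edges H)} \<times> (verts H - {x, y}))"
    and \<phi>_notin: "\<And>j w. j \<in> {1..card (edges H)} \<Longrightarrow> w \<in> verts H - {x, y} \<Longrightarrow> \<phi> j w \<notin> B"
    and finite_B: "finite B"
begin

abbreviation k :: nat where "k \<equiv> card (edges H)"
abbreviation J :: "nat set" where "J \<equiv> {1..k}"
abbreviation W :: "'a set" where "W \<equiv> verts H - {x, y}"
abbreviation E' :: "'a set set" where "E' \<equiv> edges H - {{x, y}}"

definition lift :: "nat \<Rightarrow> 'b \<Rightarrow> 'a set \<Rightarrow> 'b set" where
  "lift j b f = (\<lambda>v. if v \<in> {x, y} then b else \<phi> j v) ` f"

text \<open>Since \<open>\<nu>\<close> stays below \<open>k\<close> on \<open>E'\<close>, copy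
  \<open>k\<close> keeps \<open>\<nu>\<close> unchanged.\<close>

definition col :: "nat \<Rightarrow> 'a set \<Rightarrow> nat" where
  "col j f = (if \<nu> f = j then k else \<nu> f)"

definition E0 :: "'b set set" where
  "E0 = {lift j b f | j b f. j \<in> J \<and> b \<in> B \<and> f \<in> E'}"

text \<open>An edge that avoids \<open>B\<close> does not determine \<open>b\<close>, so only the
  pair \<open>(j, f)\<close> is chosen; \<open>lift_inj\<close> makes it unique.\<close>

definition colour :: "'b set \<Rightarrow> nat" where
  "colour e = (case SOME (j, f). j \<in> J \<and> f \<in> E' \<and> (\<exists>b\<in>B. e = lift j b f) of (j, f) \<Rightarrow> col j f)"

abbreviation G0 :: "'b graph" where
  "G0 \<equiv> (B \<union> case_prod \<phi> ` (J \<times> W), E0)"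

section \<open>Edges of the contraction\<close>

lemma edgeD: "f \<in> edges H \<Longrightarrow> f \<subseteq> verts H" "f \<in> edges H \<Longrightarrow> card f = 2"
  using simple by (auto simp: simple_graph_def all_pairs_def)

lemma finite_H: "finite (verts H)" "finite (edges H)"
  using simple finite_subset[OF _ finite_all_pairs[of "verts H"]]
  by (auto simp: simple_graph_def)

lemma xy: "{x, y} \<in> edges H" "x \<in> verts H" "y \<in> verts H" "x \<noteq> y"
proof -
  show *: "{x, y} \<in> edges H"
    using critical by (auto simp: critical_edges_def)
  show "x \<in> verts H" "y \<in> verts H" "x \<noteq> y"
    using edgeD[OF *] by auto
qed

lemma \<nu>_range: "f \<in> E' \<Longrightarrow> \<nu> f \<in> {1..<k}"
  using bij_\<nu> by (auto simp: bij_betw_def)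

lemma \<nu>_inj: "f \<in> E' \<Longrightarrow> f' \<in> E' \<Longrightarrow> \<nu> f = \<nu> f' \<longleftrightarrow> f = f'"
  using bij_\<nu> by (auto simp: bij_betw_def inj_on_def)

lemma no_common_neighbour: "{x, a} \<in> edges H \<Longrightarrow> {y, a} \<in> edges H \<Longrightarrow> False"
proof -
  assume a: "{x, a} \<in> edges H" "{y, a} \<in> edges H"
  then have "y \<noteq> a" "x \<noteq> a"
    using edgeD(2) by fastforce+
  then have "in_triangle H {x, y}"
    using a xy by (intro in_triangleI)
  then show False
    using critical by (simp add: critical_edges_def)
qed

text \<open>An edge other than \<open>{x, y}\<close> has at most one end in the contracted
  vertex.\<close>

lemma type_cases:
  assumes "f \<in> E'"
  obtains (inner) a b where "f = {a, b}" "a \<in> W" "b \<in> W" "a \<noteq> b"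
    | (outer) a v where "f = {v, a}" "a \<in> W" "v \<in> {x, y}"
proof -
  obtain a b where ab: "f = {a, b}" "a \<noteq> b" "a \<in> verts H" "b \<in> verts H"
    using assms edgeD[of f] by (auto simp: card_2_iff)
  show ?thesis
  proof (cases "a \<in> {x, y}")
    case True
    then show ?thesis
      using ab assms outer[of a b] by (auto simp: insert_commute)
  next
    case a: False
    then show ?thesis
      using ab inner[of a b] outer[of b a] by (cases "b \<in> {x, y}") (auto simp: insert_commute)
  qed
qed

text \<open>Inner edges have two ends in \<open>W\<close> and outer edges one. Distinct outer edges
  with the same end in \<open>W\<close> would make it a common neighbour of \<open>x\<close> and
  \<open>y\<close>. So contracting identifies no two edges.\<close>

lemma type_eqI:
  assumes "f \<in> E'" "f' \<in> E'" "f \<inter> W = f' \<inter> W"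
  shows "f = f'"
  using assms(1)
proof (cases rule: type_cases)
  case f: (inner a b)
  show ?thesis
    using assms(2)
  proof (cases rule: type_cases)
    case (inner a' b')
    then show ?thesis using f assms(3) by auto
  next
    case (outer a' v')
    then show ?thesis using f assms(3) by auto
  qed
next
  case f: (outer a v)
  show ?thesis
    using assms(2)
  proof (cases rule: type_cases)
    case (inner a' b')
    then show ?thesis using f assms(3) by auto
  next
    case (outer a' v')
    then have "a' = a"
      using f assms(3) by auto
    then show ?thesis
      using f outer assms(1,2) no_common_neighbour[of a] by auto
  qed
qed

lemma type_meets_W: "f \<in> E' \<Longrightarrow> \<exists>w\<in>W. w \<in> f"
  by (erule type_cases) auto

section \<open>Lifted edges and their colours\<close>

lemma \<phi>_inj: "j \<in> J \<Longrightarrow> w \<in> W \<Longrightarrow> j' \<in> J \<Longrightarrow> w' \<in> W \<Longrightarrow> \<phi> j w = \<phi> j' w' \<longleftrightarrow> j = j' \<and> w = w'"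
  using inj_on_eq_iff[OF inj_\<phi>, of "(j, w)" "(j', w')"] by simp

lemma \<phi>_mem_lift:
  assumes "j \<in> J" "b \<in> B" "f \<in> E'" "i \<in> J" "w \<in> W"
  shows "\<phi> i w \<in> lift j b f \<longleftrightarrow> i = j \<and> w \<in> f"
proof -
  have "\<phi> i w \<noteq> b"
    using \<phi>_notin assms by blast
  then show ?thesis
    using assms edgeD(1)[of f] by (auto simp: lift_def \<phi>_inj)
qed

lemma B_mem_lift:
  assumes "j \<in> J" "f \<in> E'" "b' \<in> B"
  shows "b' \<in> lift j b f \<longleftrightarrow> b' = b \<and> f \<inter> {x, y} \<noteq> {}"
proof -
  have "b' \<noteq> \<phi> j w" if "w \<in> W" for w
    using \<phi>_notin assms that by blast
  then show ?thesis
    using assms edgeD(1)[of f] by (auto simp: lift_def image_iff)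
qed

text \<open>The vertices outside \<open>B\<close> reveal the copy and the nonempty trace of
  \<open>f\<close> on \<open>W\<close>, which determines \<open>f\<close>. Nothing is claimed about
  \<open>b\<close>, which inner edges forget.\<close>

lemma lift_inj:
  assumes "j \<in> J" "b \<in> B" "f \<in> E'" "j' \<in> J" "b' \<in> B" "f' \<in> E'" "lift j b f = lift j' b' f'"
  shows "j = j' \<and> f = f'"
proof -
  have *: "i = j \<and> w \<in> f \<longleftrightarrow> i = j' \<and> w \<in> f'" if "i \<in> J" "w \<in> W" for i w
    using \<phi>_mem_lift[of j b f i w] \<phi>_mem_lift[of j' b' f' i w] that assms by simp
  then have "j = j'"
    using type_meets_W[OF assms(3)] assms(1) by blast
  then show ?thesis
    using * assms type_eqI[of f f'] by blast
qed

lemma colour_lift: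
  assumes "j \<in> J" "b \<in> B" "f \<in> E'"
  shows "colour (lift j b f) = col j f"
proof -
  have "(SOME (j', f'). j' \<in> J \<and> f' \<in> E' \<and> (\<exists>b'\<in>B. lift j b f = lift j' b' f')) = (j, f)"
    using assms lift_inj[OF assms] by (intro some_equality) auto
  then show ?thesis
    by (simp add: colour_def)
qed

lemma lift_outer: "v \<in> {x, y} \<Longrightarrow> a \<in> W \<Longrightarrow> lift j b {v, a} = {b, \<phi> j a}"
  by (auto simp: lift_def)

lemma lift_inner: "a \<in> W \<Longrightarrow> a' \<in> W \<Longrightarrow> lift j b {a, a'} = {\<phi> j a, \<phi> j a'}"
  by (auto simp: lift_def)

lemma edge_coloured_G0:
  assumes "k \<le> t"
  shows "edge_coloured t G0 colour"
proof -
  have "e \<in> all_pairs (verts G0)" "colour e \<in> {1..t}" if e: "e \<in> E0" for e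
  proof -
    obtain j b f where jbf: "j \<in> J" "b \<in> B" "f \<in> E'" "e = lift j b f"
      using e by (auto simp: E0_def)
    then show "colour e \<in> {1..t}"
      using \<nu>_range[of f] assms by (auto simp: colour_lift col_def)
    show "e \<in> all_pairs (verts G0)"
      using jbf(3)
    proof (cases rule: type_cases)
      case (inner a a')
      moreover have "\<phi> j a \<noteq> \<phi> j a'"
        using jbf(1) inner by (simp add: \<phi>_inj)
      ultimately show ?thesis
        using jbf by (auto simp: all_pairs_def lift_inner)
    next
      case (outer a v)
      moreover have "b \<noteq> \<phi> j a"
        using \<phi>_notin jbf outer by blast
      ultimately show ?thesis
        using jbf by (auto simp: all_pairs_def lift_outer)
    qed
  qed
  then show ?thesis
    using finite_B finite_H by (auto simp: edge_coloured_def simple_graph_def)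
qed

text \<open>The embedding undoes the contraction: \<open>x\<close> and \<open>y\<close> go to the
  ends of \<open>e\<close>, and all other vertices to a copy in which colour \<open>i\<close> is
  missing.\<close>

lemma rainbow_copy_insert:
  assumes "e \<in> all_pairs B" "i \<in> {1..t}"
  shows "\<exists>K. rainbow_copy H (verts G0, insert e (edges G0)) (colour(e := i)) K"
proof -
  obtain u v where uv: "e = {u, v}" "u \<in> B" "v \<in> B" "u \<noteq> v"
    using assms(1) by (auto simp: all_pairs_def card_2_iff)
  \<comment> \<open>Colours above \<open>k\<close> occur in no copy, so any copy would serve for
    them.\<close>
  define j where "j = (if i \<le> k then i else k)"
  have "k > 0"
    using xy(1) finite_H by (auto simp: card_gt_0_iff)
  then have j: "j \<in> J"
    using assms(2) by (auto simp: j_def)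
  have missing: "col j f \<noteq> i" if "f \<in> E'" for f
    using \<nu>_range[OF that] by (auto simp: col_def j_def split: if_splits)
  define F where "F = (\<lambda>w. if w = x then u else if w = y then v else \<phi> j w)"
  have \<phi>B: "\<phi> j w \<notin> {u, v}" if "w \<in> W" for w
    using \<phi>_notin[OF j that] uv by auto
  have injF: "inj_on F (verts H)"
    using \<phi>B \<phi>_inj[OF j _ j] uv(4) by (auto simp: inj_on_def F_def)
  have Fxy: "F ` {x, y} = e"
    using xy by (auto simp: F_def uv)
  \<comment> \<open>Edges at \<open>x\<close> are lifted with \<open>u\<close> and edges at
    \<open>y\<close> with \<open>v\<close>; both are available because the contracted vertex was
    blown up to all of \<open>B\<close>. For inner edges any \<open>b\<close> will do.\<close>
  have Ff: "\<exists>b\<in>B. F ` f = lift j b f" if "f \<in> E'" for f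
    using that
  proof (cases rule: type_cases)
    case (inner a b)
    then show ?thesis
      using uv(2) by (auto simp: F_def lift_def)
  next
    case (outer a w)
    then show ?thesis
      using uv xy(4) by (intro bexI[of _ "if w = x then u else v"]) (auto simp: F_def lift_def)
  qed
  have E0: "F ` f \<in> E0" "colour (F ` f) = col j f" if f: "f \<in> E'" for f
  proof -
    obtain b where b: "b \<in> B" "F ` f = lift j b f"
      using Ff[OF f] by blast
    then show "F ` f \<in> E0"
      using f j unfolding E0_def by blast
    show "colour (F ` f) = col j f"
      using colour_lift[OF j b(1) f] b(2) by simp
  qed
  \<comment> \<open>A vertex of \<open>f\<close> in \<open>W\<close> is sent outside
    \<open>e\<close>, so recolouring \<open>e\<close> leaves the lifted edges alone.\<close>
  have e: "e \<noteq> F ` f" if f: "f \<in> E'" for f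
  proof -
    obtain w where w: "w \<in> W" "w \<in> f"
      using type_meets_W[OF f] by auto
    then have "F w = \<phi> j w"
      by (simp add: F_def)
    then show ?thesis
      using w \<phi>B[OF w(1)] uv(1) by (metis image_eqI insertE singletonD)
  qed
  let ?K = "(F ` verts H, (`) F ` edges H)"
  have edges: "edges H = insert {x, y} E'"
    using xy by auto
  have "inj_on (colour(e := i)) ((`) F ` edges H)"
  proof (rule inj_on_imageI)
    have col: "((colour(e := i)) \<circ> (`) F) f = (if f = {x, y} then i else col j f)"
      if "f \<in> edges H" for f
    proof (cases "f = {x, y}")
      case False
      then show ?thesis
        using that E0(2)[of f] e[of f] by auto
    qed (simp add: Fxy del: image_insert)
    \<comment> \<open>Trading colour \<open>j\<close> for \<open>k\<close> keeps the colours
      distinct, as \<open>k\<close> is not a value of \<open>\<nu>\<close> on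
      \<open>E'\<close>.\<close>
    have diff: "col j f \<noteq> col j f'" if "f \<in> E'" "f' \<in> E'" "f \<noteq> f'" for f f'
      using that \<nu>_inj[of f f'] \<nu>_range[of f] \<nu>_range[of f'] by (auto simp: col_def)
    show "inj_on ((colour(e := i)) \<circ> (`) F) (edges H)"
    proof (rule inj_onI)
      fix f f'
      assume *: "f \<in> edges H" "f' \<in> edges H"
        "((colour(e := i)) \<circ> (`) F) f = ((colour(e := i)) \<circ> (`) F) f'"
      have "(if f = {x, y} then i else col j f) = (if f' = {x, y} then i else col j f')"
        using *(3) unfolding col[OF *(1)] col[OF *(2)] .
      then show "f = f'"
        using missing[of f] missing[of f'] diff[of f f'] *(1,2) by (auto split: if_splits)
    qed
  qed
  moreover have "isomorphic H ?K"
    using injF by (auto simp: isomorphic_def bij_betw_def)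
  moreover have "subgraph ?K (verts G0, insert e (edges G0))"
  proof -
    have "F ` verts H \<subseteq> verts G0"
      using j uv by (auto simp: F_def image_iff)
    moreover have "(`) F ` edges H \<subseteq> insert e E0"
      using E0 Fxy by (subst edges) (auto simp del: image_insert)
    ultimately show ?thesis
      by (simp add: subgraph_def)
  qed
  ultimately show ?thesis
    unfolding rainbow_copy_def by (intro exI[of _ ?K]) simp
qed

text \<open>Connectedness enters here: \<open>w\<close> is not isolated. It will force every
  \<open>w\<close> to occur in a rainbow copy.\<close>

lemma ex_type:
  assumes "w \<in> W"
  shows "\<exists>f\<in>E'. w \<in> f"
proof -
  have "(w, x) \<in> {(a, b). {a, b} \<in> edges H}\<^sup>*" "w \<noteq> x"
    using connected xy assms by (auto simp: connected_graph_def)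
  then obtain u where "{w, u} \<in> edges H"
    by (auto elim: converse_rtranclE)
  then show ?thesis
    using assms by (intro bexI[of _ "{w, u}"]) auto
qed

text \<open>Otherwise \<open>{x, y}\<close> would be pendant. It will force a rainbow copy to meet
  \<open>B\<close>.\<close>

lemma ex_type_x: "\<exists>f\<in>E'. x \<in> f"
proof (rule ccontr)
  assume "\<not> ?thesis"
  then have "{e \<in> edges H. x \<in> e} = {{x, y}}"
    using xy by auto
  then have "degree H x = 1"
    by (simp add: degree_def)
  then show False
    using degree_ge_2_if_critical[OF critical, of x] finite_H by simp
qed

text \<open>This is the degree of the contracted vertex: only \<open>{x, y}\<close> contains both
  \<open>x\<close> and \<open>y\<close>, and it is removed once from each side.\<close>

lemma card_outer_types:
  "card {f \<in> E'. f \<inter> {x, y} \<noteq> {}} + 2 = degree H x + degree H y"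
proof -
  let ?X = "{e \<in> edges H. x \<in> e}" and ?Y = "{e \<in> edges H. y \<in> e}"
  have fin: "finite ?X" "finite ?Y"
    using finite_H by auto
  have "e = {x, y}" if "e \<in> ?X" "e \<in> ?Y" for e
    using that edgeD(2)[of e] xy(4) by (auto simp: card_2_iff)
  then have "(?X - {{x, y}}) \<inter> (?Y - {{x, y}}) = {}"
    by blast
  moreover have "{f \<in> E'. f \<inter> {x, y} \<noteq> {}} = (?X - {{x, y}}) \<union> (?Y - {{x, y}})"
    by auto
  ultimately have "card {f \<in> E'. f \<inter> {x, y} \<noteq> {}} = card (?X - {{x, y}}) + card (?Y - {{x, y}})"
    using fin by (simp add: card_Un_disjoint)
  moreover have "card ?X = Suc (card (?X - {{x, y}}))" "card ?Y = Suc (card (?Y - {{x, y}}))"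
    using xy fin by (intro card.remove; simp)+
  ultimately show ?thesis
    by (simp add: degree_def)
qed

lemma lift_cong: "f \<in> E' \<Longrightarrow> f \<inter> {x, y} = {} \<Longrightarrow> lift j b f = lift j b' f"
  by (auto simp: lift_def intro!: image_cong)

lemma no_rainbow_copy: "\<not> rainbow_copy H G0 colour K"
proof

  \<comment> \<open>Colours occurring in the rainbow copy\<close>
  assume "rainbow_copy H G0 colour K"
  then have VK: "verts K \<subseteq> verts G0" and EK: "edges K \<subseteq> E0"
    and iso: "isomorphic H K" and inj: "inj_on colour (edges K)"
    by (auto simp: rainbow_copy_def subgraph_def)
  obtain F where F: "bij_betw F (verts H) (verts K)" "edges K = (`) F ` edges H"
    using iso by (auto simp: isomorphic_def)
  have finK: "finite (verts K)" "finite (edges K)"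
    using F finite_H by (auto simp: bij_betw_finite[symmetric])
  have edge_verts: "e \<subseteq> verts K" if e: "e \<in> edges K" for e
  proof -
    obtain f where "f \<in> edges H" "e = F ` f"
      using e F(2) by auto
    then show ?thesis
      using image_mono[OF edgeD(1), of f F] F(1) by (simp add: bij_betw_def)
  qed
  have edge_K: "\<exists>j\<in>J. \<exists>b\<in>B. \<exists>f\<in>E'. e = lift j b f" if "e \<in> edges K" for e
    using that EK unfolding E0_def by blast
  \<comment> \<open>\<open>K\<close> has \<open>k\<close> edges with distinct colours, all taken
    from the \<open>k\<close> colours in \<open>J\<close>.\<close>
  have "colour ` edges K = J"
  proof (rule card_subset_eq)
    show "colour ` edges K \<subseteq> J"
      using edge_coloured_G0[of k] EK by (auto simp: edge_coloured_def)
    show "card (colour ` edges K) = card J"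
      using card_edges_isomorphic[OF simple iso] by (simp add: card_image[OF inj])
  qed simp
  then have ex_colour: "\<exists>j\<in>J. \<exists>b\<in>B. \<exists>f\<in>E'. lift j b f \<in> edges K \<and> col j f = i" if i: "i \<in> J" for i
  proof -
    obtain e where e: "e \<in> edges K" "i = colour e"
      using i \<open>colour ` edges K = J\<close> by blast
    then obtain j b f where jbf: "j \<in> J" "b \<in> B" "f \<in> E'" "e = lift j b f"
      using edge_K by blast
    then have "lift j b f \<in> edges K \<and> col j f = i"
      using e colour_lift[OF jbf(1-3)] by simp
    then show ?thesis
      using jbf by blast
  qed
  \<comment> \<open>A colour \<open>\<nu> f\<close> is below \<open>k\<close>, so it is carried only
    by lifts of \<open>f\<close> to copies other than copy \<open>\<nu> f\<close>.\<close>
  have natural: "\<exists>j\<in>J. \<exists>b\<in>B. j \<noteq> \<nu> f \<and> lift j b f \<in> edges K" if f: "f \<in> E'" for f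
  proof -
    have "\<nu> f \<in> J"
      using \<nu>_range[OF f] by simp
    then obtain j b f' where *: "j \<in> J" "b \<in> B" "f' \<in> E'" "lift j b f' \<in> edges K" "col j f' = \<nu> f"
      using ex_colour by blast
    have "\<nu> f' \<noteq> j"
      using *(5) \<nu>_range[OF f] by (auto simp: col_def)
    moreover from this have "\<nu> f' = \<nu> f"
      using *(5) by (simp add: col_def)
    moreover from this have "f' = f"
      using \<nu>_inj[OF *(3) f] by blast
    ultimately show ?thesis
      using *(1,2,4) by (intro bexI[of _ j] bexI[of _ b]) auto
  qed
  have "k \<in> J"
    using xy(1) finite_H by (auto simp: Suc_le_eq card_gt_0_iff)
  \<comment> \<open>Colour \<open>k\<close> is carried only by a lift of some \<open>m\<close> to
    copy \<open>\<nu> m\<close>. As \<open>natural\<close> puts \<open>m\<close> in another copy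
    too, \<open>m\<close> occurs twice.\<close>
  then obtain jm m bm where jm: "jm \<in> J" "m \<in> E'" "bm \<in> B" "lift jm bm m \<in> edges K" "col jm m = k"
    using ex_colour by blast
  then have "jm = \<nu> m"
    using \<nu>_range[OF jm(2)] by (simp add: col_def split: if_splits)
  with jm have m: "m \<in> E'" "bm \<in> B" "lift (\<nu> m) bm m \<in> edges K" "\<nu> m \<in> J"
    by blast+

  \<comment> \<open>Counting the vertices of the rainbow copy\<close>
  define Z where "Z = verts K \<inter> B"
  define S where "S w = {j \<in> J. \<phi> j w \<in> verts K}" for w
  have SI: "j \<in> S w" if "lift j b f \<in> edges K" "w \<in> f" "w \<in> W" "j \<in> J" "b \<in> B" "f \<in> E'" for j b f w
    using that \<phi>_mem_lift[of j b f j w] edge_verts[of "lift j b f"] by (auto simp: S_def)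
  have ZI: "b \<in> Z" if "lift j b f \<in> edges K" "f \<inter> {x, y} \<noteq> {}" "j \<in> J" "b \<in> B" "f \<in> E'" for j b f
    using that B_mem_lift[of j f b b] edge_verts[of "lift j b f"] by (auto simp: Z_def)
  have fin: "finite Z" "\<And>w. finite (S w)" "finite W"
    using finK finite_H by (auto simp: Z_def S_def)
  \<comment> \<open>A lower bound for the number of copies of \<open>w\<close> in \<open>K\<close>:
    two for the ends of \<open>m\<close> in \<open>W\<close>, one for all other vertices.\<close>
  define g :: "'a \<Rightarrow> nat" where "g w = 1 + of_bool (w \<in> m)" for w
  have S_ge: "g w \<le> card (S w)" if w: "w \<in> W" for w
  proof (cases "w \<in> m")
    case True
    obtain j b where j: "j \<in> J" "b \<in> B" "j \<noteq> \<nu> m" "lift j b m \<in> edges K"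
      using natural[OF m(1)] by blast
    then have "{j, \<nu> m} \<subseteq> S w"
      using SI[of _ _ m w] m w True by blast
    from card_mono[OF fin(2) this] show ?thesis
      using j(3) True by (simp add: g_def)
  next
    case False
    obtain f where "f \<in> E'" "w \<in> f"
      using ex_type[OF w] by blast
    then have "S w \<noteq> {}"
      using natural[of f] SI[of _ _ f w] w by blast
    then show ?thesis
      using False fin(2)[of w] by (simp add: g_def Suc_le_eq card_gt_0_iff)
  qed
  have sum_g: "sum g W = card W + card (W \<inter> m)"
  proof -
    have "(\<Sum>w\<in>W. of_bool (w \<in> m)) = card (W \<inter> m)"
      using fin(3) by (subst sum_of_bool_eq) simp_all
    then show ?thesis
      unfolding g_def sum.distrib by (simp only: card_eq_sum)
  qed
  have card_Z: "1 \<le> card Z"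
  proof -
    obtain f where "f \<in> E'" "x \<in> f"
      using ex_type_x by blast
    then have "Z \<noteq> {}"
      using natural[of f] ZI[of _ _ f] by blast
    then show ?thesis
      using fin(1) by (simp add: Suc_le_eq card_gt_0_iff)
  qed
  have card_m: "1 \<le> card (W \<inter> m)"
    using type_meets_W[OF m(1)] fin(3) by (auto simp: Suc_le_eq card_gt_0_iff)
  \<comment> \<open>Both sides count the vertices of \<open>K\<close>: on the left by position, on
    the right as those of \<open>H\<close>, with \<open>2\<close> for \<open>x\<close> and
    \<open>y\<close>.\<close>
  have count: "card Z + (\<Sum>w\<in>W. card (S w)) = card W + 2"
  proof -
    let ?T = "(\<lambda>(w, j). \<phi> j w) ` (SIGMA w:W. S w)"
    have "verts K = Z \<union> ?T"
    proof (rule set_eqI, rule iffI)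
      fix v assume v: "v \<in> verts K"
      then have "v \<in> B \<or> v \<in> case_prod \<phi> ` (J \<times> W)"
        using VK by auto
      then consider "v \<in> B" | j w where "j \<in> J" "w \<in> W" "v = \<phi> j w"
        by (elim disjE imageE SigmaE) auto
      then show "v \<in> Z \<union> ?T"
        by cases (use v in \<open>auto simp: Z_def S_def image_iff\<close>)
    qed (auto simp: Z_def S_def)
    moreover have "Z \<inter> ?T = {}"
      using \<phi>_notin by (auto simp: Z_def S_def)
    moreover have "finite ?T"
      using fin by auto
    moreover have "card ?T = (\<Sum>w\<in>W. card (S w))"
    proof -
      have "inj_on (\<lambda>(w, j). \<phi> j w) (SIGMA w:W. S w)"
        unfolding inj_on_def using \<phi>_inj by (auto simp: S_def)
      then show ?thesis
        using fin by (simp add: card_image card_SigmaI)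
    qed
    ultimately have "card (verts K) = card Z + (\<Sum>w\<in>W. card (S w))"
      using fin(1) by (simp add: card_Un_disjoint)
    moreover have "card (verts K) = card (verts H)"
      using bij_betw_same_card[OF F(1)] by simp
    moreover have "card (verts H) = card W + 2"
    proof -
      have "verts H = insert x (insert y W)"
        using xy by auto
      then have "card (verts H) = card (insert x (insert y W))"
        by simp
      then show ?thesis
        using fin(3) xy(4) by simp
    qed
    ultimately show ?thesis
      by simp
  qed
  have sum_ge: "sum g W \<le> (\<Sum>w\<in>W. card (S w))"
    using S_ge by (rule sum_mono)
  \<comment> \<open>The lower bounds \<open>1\<close> for \<open>Z\<close>, \<open>card W\<close>
    and \<open>1\<close> for \<open>W \<inter> m\<close> already add up to
    \<open>card W + 2\<close>, so each is attained.\<close>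
  have "card Z = 1" "card (W \<inter> m) = 1" and sum_eq: "sum g W = (\<Sum>w\<in>W. card (S w))"
    using count sum_g sum_ge card_Z card_m by linarith+
  then obtain z s where z: "Z = {z}" and s: "W \<inter> m = {s}"
    by (auto simp: card_1_singleton_iff)
  have card_S: "card (S w) = g w" if "w \<in> W" for w
    using sum_mono_inv[OF sum_eq S_ge that fin(3)] by simp

  \<comment> \<open>Structure of the rainbow copy around its single vertex in
    \<open>B\<close>\<close>
  have zB: "z \<in> B" "z \<in> verts K"
    using z by (auto simp: Z_def)
  \<comment> \<open>The end in \<open>B\<close> can be taken to be \<open>z\<close> throughout:
    outer edges have no other choice, and inner edges do not depend on it.\<close>
  have to_z: "lift j b f = lift j z f" if "lift j b f \<in> edges K" "j \<in> J" "b \<in> B" "f \<in> E'" for j b f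
  proof (cases "f \<inter> {x, y} = {}")
    case True
    then show ?thesis
      using lift_cong that(4) by blast
  next
    case False
    then show ?thesis
      using ZI[OF that(1) False that(2-4)] z by simp
  qed
  have edge_z: "\<exists>j\<in>J. \<exists>f\<in>E'. e = lift j z f" if e: "e \<in> edges K" for e
  proof -
    obtain j b f where "j \<in> J" "b \<in> B" "f \<in> E'" "e = lift j b f"
      using edge_K[OF e] by blast
    with to_z[of j b f] e show ?thesis
      by blast
  qed
  have "\<exists>j. j \<in> J \<and> j \<noteq> \<nu> f \<and> lift j z f \<in> edges K" if f: "f \<in> E'" for f
  proof -
    obtain j b where "j \<in> J" "b \<in> B" "j \<noteq> \<nu> f" "lift j b f \<in> edges K"
      using natural[OF f] by blast
    with to_z[of j b f] f show ?thesis
      by auto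
  qed
  \<comment> \<open>\<open>\<iota> f\<close> is a copy that supplies the colour
    \<open>\<nu> f\<close>; the second lift of \<open>m\<close>, in copy \<open>\<nu> m\<close>, is
    kept apart from it.\<close>
  then obtain \<iota> where \<iota>: "\<And>f. f \<in> E' \<Longrightarrow> \<iota> f \<in> J" "\<And>f. f \<in> E' \<Longrightarrow> \<iota> f \<noteq> \<nu> f"
    "\<And>f. f \<in> E' \<Longrightarrow> lift (\<iota> f) z f \<in> edges K"
    by metis
  have mz: "lift (\<nu> m) z m \<in> edges K"
    using to_z[OF m(3) m(4) m(2) m(1)] m(3) by simp
  have uniq: "i = j" if "w \<in> W" "w \<noteq> s" "i \<in> S w" "j \<in> S w" for i j w
  proof -
    have "w \<notin> m"
      using s that by auto
    then have "card (S w) = 1"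
      using card_S[OF that(1)] by (simp add: g_def)
    then show ?thesis
      using that by (auto simp: card_1_singleton_iff)
  qed
  have S_s: "S s = {\<nu> m, \<iota> m}"
  proof (rule sym, rule card_subset_eq)
    have "s \<in> W" "s \<in> m"
      using s by auto
    then show "{\<nu> m, \<iota> m} \<subseteq> S s" "card {\<nu> m, \<iota> m} = card (S s)"
      using SI[of _ z m s] mz \<iota>[OF m(1)] m zB card_S[of s] by (auto simp: g_def)
  qed (rule fin)
  \<comment> \<open>Triangles of \<open>H\<close> through \<open>x\<close> or \<open>y\<close> will
    be transferred to \<open>z\<close> by this. A vertex \<open>w\<close> other than
    \<open>s\<close> has a single copy in \<open>K\<close>; for \<open>s\<close> the edge is
    \<open>m\<close>, and both its lifts lie in \<open>K\<close>.\<close>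
  have at_z: "{z, \<phi> j w} \<in> edges K" if w: "w \<in> W" "j \<in> S w" and f: "{v, w} \<in> edges H" "v \<in> {x, y}" for j v w
  proof -
    have fE: "{v, w} \<in> E'" and lift: "lift i z {v, w} = {z, \<phi> i w}" for i
      using w f by (auto simp: lift_def)
    have "lift j z {v, w} \<in> edges K"
    proof (cases "w = s")
      case True
      have "{v, w} \<inter> W = {s}"
        using True w(1) f(2) by blast
      then have "{v, w} \<inter> W = m \<inter> W"
        using s by (simp only: Int_commute)
      then have "{v, w} = m"
        by (rule type_eqI[OF fE m(1)])
      moreover have "j = \<nu> m \<or> j = \<iota> m"
        using w(2) S_s unfolding True by blast
      ultimately show ?thesis
        using mz \<iota>(3)[OF m(1)] by metis
    next
      case False
      have "\<iota> {v, w} \<in> S w"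
        using SI[OF \<iota>(3)[OF fE] _ w(1) \<iota>(1)[OF fE] zB(1) fE] by simp
      from uniq[OF w(1) False this w(2)] show ?thesis
        using \<iota>(3)[OF fE] by simp
    qed
    then show ?thesis
      by (simp add: lift)
  qed

  \<comment> \<open>Degrees and critical edges of the rainbow copy\<close>
  have degree_K: "degree K (\<phi> i w) \<le> degree H w" if "i \<in> J" "w \<in> W" for i w
  proof -
    have "{e \<in> edges K. \<phi> i w \<in> e} \<subseteq> lift i z ` {f \<in> edges H. w \<in> f}"
    proof
      fix e assume e: "e \<in> {e \<in> edges K. \<phi> i w \<in> e}"
      then obtain j f where "j \<in> J" "f \<in> E'" "e = lift j z f"
        using edge_z by blast
      then show "e \<in> lift i z ` {f \<in> edges H. w \<in> f}"
        using e \<phi>_mem_lift[of j z f i w] that zB by auto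
    qed
    then show ?thesis
      unfolding degree_def using finite_H by (intro surj_card_le) auto
  qed
  have degree_z: "degree H x + degree H y \<le> Suc (degree K z)"
  proof -
    let ?D = "{f \<in> E'. f \<inter> {x, y} \<noteq> {}}"
    \<comment> \<open>The outer edges in their chosen copies contribute
      \<open>degree H x + degree H y - 2\<close> edges at \<open>z\<close>, and the second lift of
      \<open>m\<close> one more.\<close>
    let ?P = "insert (\<nu> m, m) ((\<lambda>f. (\<iota> f, f)) ` ?D)"
    have "m \<inter> {x, y} \<noteq> {}"
      using m(1) s by (cases rule: type_cases) auto
    then have mD: "m \<in> ?D"
      using m(1) by blast
    have P: "j \<in> J \<and> f \<in> ?D \<and> lift j z f \<in> edges K" if "(j, f) \<in> ?P" for j f
      using that mD m(4) mz \<iota> by auto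
    have "inj_on (\<lambda>(j, f). lift j z f) ?P"
      using P lift_inj zB(1) unfolding inj_on_def by (clarify, metis (no_types, lifting) mem_Collect_eq)
    moreover have "(\<lambda>(j, f). lift j z f) ` ?P \<subseteq> {e \<in> edges K. z \<in> e}"
    proof (rule image_subsetI)
      fix p assume p: "p \<in> ?P"
      obtain j f where jf: "p = (j, f)"
        by (cases p)
      then have *: "j \<in> J" "f \<in> E'" "f \<inter> {x, y} \<noteq> {}" "lift j z f \<in> edges K"
        using P[of j f] p by blast+
      have "z \<in> lift j z f"
        using B_mem_lift[OF *(1,2) zB(1)] *(3) by blast
      then show "(case p of (j, f) \<Rightarrow> lift j z f) \<in> {e \<in> edges K. z \<in> e}"
        using *(4) jf by simp
    qed
    moreover have "finite {e \<in> edges K. z \<in> e}"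
      using finK by simp
    ultimately have "card ?P \<le> degree K z"
      unfolding degree_def by (rule card_inj_on_le)
    moreover have "card ?P = Suc (card ?D)"
    proof -
      have "(\<nu> m, m) \<notin> (\<lambda>f. (\<iota> f, f)) ` ?D"
        using \<iota>(2)[OF m(1)] by auto
      moreover have "finite ?D"
        using finite_H by simp
      moreover have "inj_on (\<lambda>f. (\<iota> f, f)) ?D"
        by (auto simp: inj_on_def)
      ultimately show ?thesis
        by (simp add: card_image)
    qed
    ultimately show ?thesis
      using card_outer_types by simp
  qed
  \<comment> \<open>The degree sum of such an edge would be at least
    \<open>degree H x + degree H y - 1\<close> from \<open>z\<close> plus \<open>2\<close> from the
    other end, above the maximum over critical edges, which \<open>K\<close> shares with
    \<open>H\<close>.\<close>
  have z_notin: "z \<notin> e" if e: "e \<in> critical_edges K" for e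
  proof
    assume "z \<in> e"
    have eK: "e \<in> edges K"
      using e by (auto simp: critical_edges_def)
    then obtain j f where jf: "j \<in> J" "f \<in> E'" "e = lift j z f"
      using edge_z by blast
    have "f \<inter> {x, y} \<noteq> {}"
      using \<open>z \<in> e\<close> B_mem_lift jf zB(1) by blast
    with jf(2) obtain v w where vw: "w \<in> W" "v \<in> {x, y}" "f = {v, w}"
      by (cases rule: type_cases) auto
    have ew: "e = {z, \<phi> j w}" and "z \<noteq> \<phi> j w"
      using jf(3) vw lift_outer \<phi>_notin[OF jf(1) vw(1)] zB(1) by auto
    then have sum_e: "sum (degree K) e = degree K z + degree K (\<phi> j w)"
      by simp
    have "2 \<le> degree K (\<phi> j w)"
      using degree_ge_2_if_critical[OF e] finK ew by simp
    moreover have "sum (degree K) e \<le> degree H x + degree H y"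
    proof -
      obtain e' where e': "e' \<in> critical_edges H" "e = F ` e'"
        using e critical_edges_iso[OF simple F] by auto
      then have "sum (degree K) e = sum (degree H) e'"
        using sum_degree_iso[OF simple F] by (auto simp: critical_edges_def)
      then show ?thesis
        using maximal[OF e'(1)] xy(4) by simp
    qed
    ultimately show False
      using degree_z sum_e by linarith
  qed
  have "critical_edges K \<subseteq> (\<lambda>f. lift (\<iota> f) z f) ` (critical_edges H - {{x, y}})"
  proof
    fix e assume e: "e \<in> critical_edges K"
    then have eK: "e \<in> edges K"
      by (auto simp: critical_edges_def)
    then obtain j f where jf: "j \<in> J" "f \<in> E'" "e = lift j z f"
      using edge_z by blast
    have "f \<inter> {x, y} = {}"
      using z_notin[OF e] B_mem_lift jf zB(1) by blast
    with jf(2) obtain a b where ab: "a \<in> W" "b \<in> W" "a \<noteq> b" "f = {a, b}"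
      by (cases rule: type_cases) auto
    have S_edge: "i \<in> S a'" "i \<in> S b'"
      if "lift i z {a', b'} \<in> edges K" "i \<in> J" "{a', b'} \<in> E'" "a' \<in> W" "b' \<in> W" for i a' b'
      using SI[OF that(1) _ _ that(2) zB(1) that(3)] that by auto
    have j: "j \<in> S a" "j \<in> S b"
      using S_edge[of j a b] eK jf ab by auto
    have e_ab: "e = {\<phi> j a, \<phi> j b}" and neq: "\<phi> j a \<noteq> \<phi> j b"
      using jf ab by (auto simp: lift_inner \<phi>_inj)
    have "\<iota> f \<in> S a" "\<iota> f \<in> S b"
      using S_edge[of "\<iota> f" a b] \<iota>[OF jf(2)] jf ab by auto
    \<comment> \<open>At least one of \<open>a\<close> and \<open>b\<close> differs from
      \<open>s\<close>, and its single copy forces \<open>j\<close>.\<close>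
    then have "\<iota> f = j"
      using uniq j ab by metis
    moreover have "\<not> pendant H f"
    proof -
      have "2 \<le> degree H a'" if "a' \<in> f" for a'
      proof -
        have "\<phi> j a' \<in> e" "a' \<in> W"
          using that e_ab ab by auto
        then show ?thesis
          using degree_ge_2_if_critical[OF e _ finK(2), of "\<phi> j a'"] degree_K[OF jf(1), of a']
          by linarith
      qed
      then show ?thesis
        by (force simp: pendant_def)
    qed
    moreover have "\<not> in_triangle H f"
    proof
      assume "in_triangle H f"
      then obtain d where d: "{a, d} \<in> edges H" "{b, d} \<in> edges H" "a \<noteq> d" "b \<noteq> d"
        unfolding ab(4) by (rule in_triangleE)
      \<comment> \<open>The third vertex of the triangle in \<open>K\<close> is \<open>z\<close> if
        \<open>d\<close> was contracted, and \<open>\<phi> j d\<close> otherwise.\<close>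
      have "\<exists>v. {\<phi> j b, v} \<in> edges K \<and> {\<phi> j a, v} \<in> edges K \<and> \<phi> j a \<noteq> v \<and> \<phi> j b \<noteq> v"
      proof (cases "d \<in> {x, y}")
        case True
        have "{z, \<phi> j a} \<in> edges K" "{z, \<phi> j b} \<in> edges K"
          using at_z[of a j d] at_z[of b j d] ab j d True by (auto simp: insert_commute)
        moreover have "\<phi> j a \<noteq> z" "\<phi> j b \<noteq> z"
          using \<phi>_notin[OF jf(1)] ab zB(1) by auto
        ultimately show ?thesis
          by (auto simp: insert_commute)
      next
        case False
        then have dW: "d \<in> W"
          using d edgeD(1) by blast
        have ad: "{a, d} \<in> E'" and bd: "{b, d} \<in> E'"
          using d ab by auto
        have "\<iota> {a, d} \<in> S a" "\<iota> {a, d} \<in> S d" "\<iota> {b, d} \<in> S b" "\<iota> {b, d} \<in> S d"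
          using S_edge[OF \<iota>(3) \<iota>(1)] ad bd ab dW by auto
        \<comment> \<open>At most one of \<open>a\<close>, \<open>b\<close>, \<open>d\<close> is
          \<open>s\<close>. If it is \<open>a\<close>, the edge \<open>{b, d}\<close> lies in copy
          \<open>j\<close> because of \<open>b\<close>, and then \<open>d\<close> forces
          \<open>{a, d}\<close> into copy \<open>j\<close> as well; the case of \<open>b\<close> is
          symmetric.\<close>
        then have "\<iota> {a, d} = j" "\<iota> {b, d} = j"
          using uniq j ab d dW by metis+
        then have "{\<phi> j a, \<phi> j d} \<in> edges K" "{\<phi> j b, \<phi> j d} \<in> edges K"
          using \<iota>(3)[OF ad] \<iota>(3)[OF bd] ab dW by (simp_all add: lift_inner)
        then show ?thesis
          using jf(1) ab dW d \<phi>_inj by blast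
      qed
      then have "in_triangle K e"
        unfolding e_ab using eK neq e_ab by (blast intro: in_triangleI)
      then show False
        using e by (simp add: critical_edges_def)
    qed
    ultimately show "e \<in> (\<lambda>f. lift (\<iota> f) z f) ` (critical_edges H - {{x, y}})"
      using jf by (auto simp: critical_edges_def)
  qed
  moreover have fin_crit: "finite (critical_edges H)"
    using finite_H by (simp add: critical_edges_def)
  ultimately have "card (critical_edges K) \<le> card (critical_edges H - {{x, y}})"
    by (intro surj_card_le) auto
  also have "\<dots> < card (critical_edges H)"
    using critical fin_crit by (intro card_Diff1_less)
  finally show False
    using card_critical_edges_iso[OF simple F] by simp
qed

end

section \<open>The linear upper bound\<close>

text \<open>The lower bound on \<open>n\<close> makes room for the \<open>k\<close> disjoint copies
  of \<open>W\<close>; the remaining vertices form the independent set.\<close>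

lemma ex_saturated_graph:
  assumes "simple_graph H" "connected_graph H" "critical_edges H \<noteq> {}"
    and t: "card (edges H) \<le> t"
    and n: "card (edges H) * (card (verts H) - 2) \<le> n"
  shows "\<exists>(G :: nat graph) c. card (verts G) = n \<and> rainbow_saturated t H G c \<and>
    card (edges G) \<le> card (edges H) * (card (verts H) - 2) * n"
proof -
  let ?k = "card (edges H)"
  have fin: "finite (verts H)" "finite (edges H)"
    using assms(1) finite_subset[OF _ finite_all_pairs] by (auto simp: simple_graph_def)
  have fin_crit: "finite (critical_edges H)"
    using fin by (simp add: critical_edges_def)
  obtain e where e: "e \<in> critical_edges H"
    "\<And>e'. e' \<in> critical_edges H \<Longrightarrow> sum (degree H) e' \<le> sum (degree H) e"
  proof -
    have "Max (sum (degree H) ` critical_edges H) \<in> sum (degree H) ` critical_edges H"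
      using fin_crit assms(3) by (intro Max_in) auto
    then obtain e where "e \<in> critical_edges H"
      "Max (sum (degree H) ` critical_edges H) = sum (degree H) e"
      by (rule imageE)
    then show thesis
      using that[of e] fin_crit by (metis Max_ge finite_imageI imageI)
  qed
  then have "e \<in> edges H"
    by (simp add: critical_edges_def)
  then have e_H: "e \<subseteq> verts H" "card e = 2"
    using assms(1) by (auto simp: simple_graph_def all_pairs_def)
  then obtain x y where xy: "e = {x, y}" "x \<noteq> y"
    by (auto simp: card_2_iff)
  let ?W = "verts H - {x, y}" and ?J = "{1..?k}" and ?E = "edges H - {{x, y}}"
  have card_W: "card ?W = card (verts H) - 2"
    using e_H xy fin by (simp add: card_Diff_subset)
  have "card ?E = card {1..<?k}"
    using \<open>e \<in> edges H\<close> fin xy by simp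
  then obtain \<nu> where \<nu>: "bij_betw \<nu> ?E {1..<?k}"
    using fin finite_same_card_bij[of ?E "{1..<?k}"] by auto
  have "card (?J \<times> ?W) \<le> card {..<n}"
    using n card_W by (simp add: card_cartesian_product)
  then obtain h where h: "inj_on h (?J \<times> ?W)" "h ` (?J \<times> ?W) \<subseteq> {..<n}"
    using card_le_inj[of "?J \<times> ?W" "{..<n}"] fin by auto
  let ?A = "h ` (?J \<times> ?W)"
  have card_A: "card ?A = ?k * (card (verts H) - 2)"
    unfolding card_image[OF h(1)] by (simp add: card_cartesian_product card_W)
  \<comment> \<open>\<open>B\<close> is the complement of the image of \<open>h\<close>; it is empty
    when \<open>n\<close> equals the lower bound.\<close>
  interpret contraction_copies H x y \<nu> "curry h" "{..<n} - ?A"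
    using assms(1,2) e xy \<nu> h by unfold_locales auto
  have V: "verts G0 = {..<n}"
    using h(2) by auto
  have compl: "{..<n} - ({..<n} - ?A) = ?A"
    using h(2) by blast
  have "\<exists>E c. rainbow_saturated t H (verts G0, E) c \<and>
    card E \<le> card (verts G0 - ({..<n} - ?A)) * card (verts G0)"
  proof (rule rainbow_saturated_extension[OF edge_coloured_G0[OF t]])
    show "\<nexists>K. rainbow_copy H G0 colour K"
      using no_rainbow_copy by blast
    show "{..<n} - ?A \<subseteq> verts G0"
      unfolding V by blast
  qed (rule rainbow_copy_insert)
  then obtain E c where "rainbow_saturated t H ({..<n}, E) c"
    "card E \<le> ?k * (card (verts H) - 2) * card {..<n}"
    unfolding V compl card_A by blast
  then show ?thesis
    by (intro exI[of _ "({..<n}, E)"] exI[of _ c]) simp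
qed

theorem theorem3p5:
  fixes H :: "'a graph" and t n :: nat
  assumes "simple_graph H"
    and "connected_graph H"
    and "card (verts H) \<ge> 3"
    and "\<exists>e\<in>edges H. \<not> pendant H e \<and> \<not> in_triangle H e"
    and "t \<ge> card (edges H)"
    and "n \<ge> 1"
  shows "rainbow_sat t n H \<le> card (edges H) * (card (verts H) - 2) * n"
proof -
  let ?c = "card (edges H) * (card (verts H) - 2)"
  have fin: "finite (edges H)"
    using assms(1) finite_subset[OF _ finite_all_pairs] by (auto simp: simple_graph_def)
  have crit: "critical_edges H \<noteq> {}"
    using assms(4) by (auto simp: critical_edges_def)
  have "\<exists>(G :: nat graph) c. card (verts G) = n \<and> rainbow_saturated t H G c \<and>
    card (edges G) \<le> ?c * n"
  proof (cases "?c \<le> n")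
    case True
    then show ?thesis
      using ex_saturated_graph assms crit by blast
  next
    case False
    \<comment> \<open>For small \<open>n\<close> the monochromatic complete graph is sparse enough.
      Its saturation needs two edges in \<open>H\<close>, which an end of a critical edge
      provides.\<close>
    obtain e v where e: "e \<in> critical_edges H" "v \<in> e"
      using crit assms(1) by (force simp: critical_edges_def simple_graph_def all_pairs_def card_2_iff)
    have "2 \<le> degree H v"
      by (rule degree_ge_2_if_critical[OF e fin])
    also have "\<dots> \<le> card (edges H)"
      unfolding degree_def using fin by (intro card_mono) auto
    finally have mono: "rainbow_saturated t H ({..<n}, all_pairs {..<n}) (\<lambda>_. 1)"
      using assms by (intro rainbow_saturated_complete) auto
    have "card (all_pairs {..<n}) \<le> n * n"
    proof -
      have "all_pairs ({} :: nat set) = {}"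
        by (auto simp: all_pairs_def)
      then show ?thesis
        using card_all_pairs_diff_le[of "{..<n}" "{}"] by simp
    qed
    moreover have "n * n \<le> ?c * n"
      using False by (intro mult_right_mono) auto
    ultimately have "card (all_pairs {..<n}) \<le> ?c * n"
      by linarith
    then show ?thesis
      using mono
      by (intro exI[of _ "({..<n}, all_pairs {..<n})"] exI[of _ "\<lambda>_. 1"]) simp
  qed
  then obtain G :: "nat graph" and c where "card (verts G) = n" "rainbow_saturated t H G c"
    "card (edges G) \<le> ?c * n"
    by blast
  then have "rainbow_sat t n H \<le> card (edges G)"
    unfolding rainbow_sat_def by (intro Least_le) blast
  with \<open>card (edges G) \<le> ?c * n\<close> show ?thesis
    by simp
qed

end
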